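(* Let $A(x,D)=(a_{ij}(x,D))_{1\le i,j\le q}$ be a Douglis-Nirenberg system with $a_{ij}\in S^{l_i+m_j}_\delta(\mathbb R^n\times\mathbb R^n)$, where $0\le\delta<1$, $l_1,\dots,l_q,m_1,\dots,m_q\in\mathbb R$, and the numbers $r_i:=l_i+m_i$ satisfy $r_1>r_2>\dots>r_q\ge 0$. Let $\Lambda=\Lambda(\theta)$ with $0<\theta<\pi$. Then the following two conditions are equivalent. (1) ($\Lambda$-ellipticity) There exist constants $C>0$ and $R\ge 0$ such that $$|\det(A(x,\xi)-\lambda I)|\ge C\,(\langle\xi\rangle^{r_1}+|\lambda|)\cdots(\langle\xi\rangle^{r_q}+|\lambda|)$$ for all $x\in\mathbb R^n$, all $\xi\in\mathbb R^n$ with $|\xi|\ge R$, and all $\lambda\in\Lambda$. (2) ($\Lambda$-ellipticity with principal minors) For each $1\le\kappa\le q$ there exist constants $C>0$ and $R\ge0$ such that $$|\det(A[\kappa](x,\xi)-\lambda E_\kappa)|\ge C\,\langle\xi\rangle^{r_1+\dots+r_{\kappa-1}}(\langle\xi\rangle^{r_\kappa}+|\lambda|)$$ for all $x\in\mathbb R^n$, all $\xi\in\mathbb R^n$ with $|\xi|\ge R$, and all $\lambda\in\Lambda$.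
   Context: $\langle\xi\rangle:=(1+|\xi|^2)^{1/2}$, $D:=-i\partial$. For $\mu\in\mathbb R$ and $0\le\delta<1$, $S^\mu_\delta(\mathbb R^n\times\mathbb R^n)$ is the space of all smooth $a:\mathbb R^n\times\mathbb R^n\to\mathbb C$ such that for all multi-indices $\alpha,\beta$ one has $\sup_{x,\xi}|D^\alpha_\xi D^\beta_x a(x,\xi)|\,\langle\xi\rangle^{-\mu+|\alpha|-\delta|\beta|}<\infty$. A Douglis-Nirenberg system is a matrix of pseudodifferential operators with symbols $a_{ij}\in S^{l_i+m_j}_\delta$; its matrix symbol is $A(x,\xi)=(a_{ij}(x,\xi))_{1\le i,j\le q}$. The sector is $\Lambda(\theta)=\{re^{i\varphi} : r\ge0,\ \theta\le\varphi\le2\pi-\theta\}$. For $1\le\kappa\le q$, $A[\kappa](x,\xi)=(a_{ij}(x,\xi))_{1\le i,j\le\kappa}$ and $E_\kappa=\mathrm{diag}(0,\dots,0,1)\in\mathbb C^{\kappa\times\kappa}$. An empty sum in the exponent ($\kappa=1$) is $0$. *)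

theory Defs
  imports "HOL-Analysis.Analysis" "Jordan_Normal_Form.Determinant"
begin

definition japanese :: "'a::real_normed_vector \<Rightarrow> real"
  where "japanese \<xi> = sqrt (1 + (norm \<xi>)\<^sup>2)"

primrec Ck :: "nat \<Rightarrow> ('a::euclidean_space \<Rightarrow> 'b::real_normed_vector) \<Rightarrow> bool"
  where
    "Ck 0 f \<longleftrightarrow> continuous_on UNIV f"
  | "Ck (Suc k) f \<longleftrightarrow>
       f differentiable_on UNIV \<and> (\<forall>v. Ck k (\<lambda>z. frechet_derivative f (at z) v))"

definition smooth :: "('a::euclidean_space \<Rightarrow> 'b::real_normed_vector) \<Rightarrow> bool"
  where "smooth f \<longleftrightarrow> (\<forall>k. Ck k f)"

definition D_dir :: "'a::real_normed_vector \<Rightarrow> ('a \<Rightarrow> complex) \<Rightarrow> 'a \<Rightarrow> complex"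
  where "D_dir v f = (\<lambda>z. - \<i> * frechet_derivative f (at z) v)"

text \<open>\<open>D_multi e \<alpha>\<close> is the composition over all \<open>i\<close> of the powers \<open>\<alpha> i\<close> of the operators
  \<open>D_dir (e i)\<close>. The index type carries no order, so an enumeration of it is chosen; on smooth
  functions the operators commute and the choice does not matter.\<close>

definition D_multi ::
    "('n::finite \<Rightarrow> 'a::real_normed_vector) \<Rightarrow> ('n \<Rightarrow> nat) \<Rightarrow> ('a \<Rightarrow> complex) \<Rightarrow> 'a \<Rightarrow> complex"
  where "D_multi e \<alpha> f =
    foldr (\<lambda>i. D_dir (e i) ^^ \<alpha> i) (SOME is. distinct is \<and> set is = UNIV) f"

definition D_x :: "('n::finite \<Rightarrow> nat) \<Rightarrow>
    ((real ^ 'n) \<times> (real ^ 'n) \<Rightarrow> complex) \<Rightarrow> (real ^ 'n) \<times> (real ^ 'n) \<Rightarrow> complex"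
  where "D_x = D_multi (\<lambda>i. (axis i 1, 0))"

definition D_\<xi> :: "('n::finite \<Rightarrow> nat) \<Rightarrow>
    ((real ^ 'n) \<times> (real ^ 'n) \<Rightarrow> complex) \<Rightarrow> (real ^ 'n) \<times> (real ^ 'n) \<Rightarrow> complex"
  where "D_\<xi> = D_multi (\<lambda>i. (0, axis i 1))"

definition multi_abs :: "('n::finite \<Rightarrow> nat) \<Rightarrow> nat"
  where "multi_abs \<alpha> = (\<Sum>i\<in>UNIV. \<alpha> i)"

definition symbol_class ::
    "real \<Rightarrow> real \<Rightarrow> ((real ^ 'n::finite) \<times> (real ^ 'n) \<Rightarrow> complex) set"
  where "symbol_class \<delta> \<mu> = {a. smooth a \<and>
    (\<forall>\<alpha> \<beta>. bdd_above (range (\<lambda>(x, \<xi>). cmod (D_\<xi> \<alpha> (D_x \<beta> a) (x, \<xi>)) *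
        japanese \<xi> powr (- \<mu> + real (multi_abs \<alpha>) - \<delta> * real (multi_abs \<beta>)))))}"

definition sector :: "real \<Rightarrow> complex set"
  where "sector \<theta> = {rcis r \<phi> | r \<phi>. 0 \<le> r \<and> \<theta> \<le> \<phi> \<and> \<phi> \<le> 2 * pi - \<theta>}"

text \<open>The families \<open>a\<close>, \<open>l\<close>, \<open>m\<close> are indexed by \<open>1, \<dots>, q\<close>, whereas the entries of a
  matrix are numbered from \<open>0\<close>; hence the shift in \<open>sys_mat\<close>.
  A system of operators \<open>a\<^sub>i\<^sub>j(x, D)\<close> is represented by its family of symbols.\<close>

definition douglis_nirenberg ::
    "real \<Rightarrow> nat \<Rightarrow> (nat \<Rightarrow> real) \<Rightarrow> (nat \<Rightarrow> real) \<Rightarrow>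
     (nat \<Rightarrow> nat \<Rightarrow> (real ^ 'n::finite) \<times> (real ^ 'n) \<Rightarrow> complex) \<Rightarrow> bool"
  where "douglis_nirenberg \<delta> q l m a \<longleftrightarrow>
    (\<forall>i\<in>{1..q}. \<forall>j\<in>{1..q}. a i j \<in> symbol_class \<delta> (l i + m j))"

definition sys_mat :: "(nat \<Rightarrow> nat \<Rightarrow> 'a \<Rightarrow> complex) \<Rightarrow> nat \<Rightarrow> 'a \<Rightarrow> complex mat"
  where "sys_mat a \<kappa> z = mat \<kappa> \<kappa> (\<lambda>(i, j). a (Suc i) (Suc j) z)"

definition E_mat :: "nat \<Rightarrow> complex mat"
  where "E_mat \<kappa> = mat_diag \<kappa> (\<lambda>i. if Suc i = \<kappa> then 1 else 0)"

end

theory Submission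
  imports Defs
begin

text \<open>Write \<open>w = \<langle>\<xi>\<rangle>\<close> and \<open>u\<^sub>i = w powr r\<^sub>i\<close>. The symbol estimates with
  \<open>\<alpha> = \<beta> = 0\<close> bound the normalised entries \<open>b\<^sub>i\<^sub>j = a\<^sub>i\<^sub>j / w powr (l\<^sub>i + m\<^sub>j)\<close>. Rescaling rows and
  columns turns both conditions into statements about one family of matrices: for a vector \<open>p\<close> of
  weights in \<open>[0, 1]\<close> and \<open>\<bar>\<sigma>\<bar> = 1\<close>, let \<open>T(p)\<close> have the entries
  \<open>p\<^sub>i b\<^sub>i\<^sub>j - (1 - p\<^sub>i) \<sigma> \<delta>\<^sub>i\<^sub>j\<close>, so that \<open>p\<^sub>i\<close> moves row \<open>i\<close> from \<open>-\<sigma>\<close> times a unit row to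
  row \<open>i\<close> of \<open>b\<close>. Then, for shifts \<open>\<rho>\<^sub>i \<ge> 0\<close>,
  \<open>det (A - \<sigma> diag \<rho>) = (\<Prod>i. u\<^sub>i + \<rho>\<^sub>i) det T(p)\<close> with \<open>p\<^sub>i = u\<^sub>i / (u\<^sub>i + \<rho>\<^sub>i)\<close>
  (\<open>det_shifted_symbol\<close>).

  With \<open>\<lambda> = \<rho> \<sigma>\<close>, ellipticity says that \<open>det T\<close> is bounded away from zero along the curve
  \<open>\<rho> \<mapsto> (u\<^sub>i / (u\<^sub>i + \<rho>))\<^sub>i\<close>, which runs from the corner \<open>(1, \<dots>, 1)\<close> of the cube towards the
  corner \<open>(0, \<dots>, 0)\<close>. The condition on the minor \<open>A[\<kappa>]\<close> says the same for
  the edge of the cube that consists of the points \<open>(1, \<dots>, 1, s, 0, \<dots>, 0)\<close> with \<open>s\<close> in position \<open>\<kappa>\<close>, because there the rows below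
  \<open>\<kappa>\<close> contribute only a factor of modulus one (\<open>norm_det_edge\<close>). These \<open>q\<close> edges form a
  broken line between these two corners. Since \<open>r\<^sub>1 > \<dots> > r\<^sub>q\<close>, the numbers \<open>u\<^sub>i\<close> become widely
  separated as \<open>w\<close> grows: whenever \<open>\<rho>\<close> is comparable to \<open>u\<^sub>\<kappa>\<close>, it is negligible against the
  earlier and dominates the later \<open>u\<^sub>i\<close>. Hence curve and broken line are uniformly
  close to each other (\<open>curve_near_edges\<close> and \<open>edges_near_curve\<close>). As \<open>det T\<close> is Lipschitz in
  \<open>p\<close>, uniformly in \<open>x, \<xi>, \<sigma>\<close> (\<open>det_blend_lipschitz\<close>), a lower bound on one of them gives a
  lower bound on the other for large \<open>\<bar>\<xi>\<bar>\<close>.\<close>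

section \<open>Determinants under scaling and perturbation\<close>

lemma det_scale_rows_cols:
  fixes f :: "nat \<Rightarrow> nat \<Rightarrow> complex"
  shows "Determinant.det (Matrix.mat n n (\<lambda>(i, j). c i * f i j * d j)) =
    (\<Prod>i<n. c i) * (\<Prod>j<n. d j) * Determinant.det (Matrix.mat n n (\<lambda>(i, j). f i j))"
proof -
  have "Matrix.mat n n (\<lambda>(i, j). c i * f i j * d j) =
      mat_diag n c * Matrix.mat n n (\<lambda>(i, j). f i j) * mat_diag n d"
    by (subst mat_diag_mult_left[of _ n n], simp, subst mat_diag_mult_right[of _ n n]) auto
  moreover have "Determinant.det (mat_diag n e) = (\<Prod>i<n. e i)" for e :: "nat \<Rightarrow> complex"
    by (subst det_lower_triangular[of n])
       (auto simp: mat_diag_def prod_list_diag_prod atLeast0LessThan)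
  ultimately show ?thesis
    by (simp add: det_mult[of _ n] mult_carrier_mat[of _ n n])
qed

lemma norm_det_diff_le_of_norm_le_1:
  fixes f g :: "nat \<Rightarrow> nat \<Rightarrow> complex"
  assumes "\<And>i j. i < n \<Longrightarrow> j < n \<Longrightarrow> norm (f i j) \<le> 1"
    and "\<And>i j. i < n \<Longrightarrow> j < n \<Longrightarrow> norm (g i j) \<le> 1"
    and "\<And>i j. i < n \<Longrightarrow> j < n \<Longrightarrow> norm (f i j - g i j) \<le> e"
  shows "norm (Determinant.det (Matrix.mat n n (\<lambda>(i, j). f i j)) -
    Determinant.det (Matrix.mat n n (\<lambda>(i, j). g i j))) \<le> fact n * (real n * e)"
proof -
  let ?P = "{\<pi>. \<pi> permutes {0..<n}}"
  have det: "Determinant.det (Matrix.mat n n (\<lambda>(i, j). h i j)) =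
      (\<Sum>\<pi>\<in>?P. signof \<pi> * (\<Prod>i = 0..<n. h i (\<pi> i)))" for h :: "nat \<Rightarrow> nat \<Rightarrow> complex"
    by (subst det_def'[of _ n]) (auto intro!: sum.cong prod.cong)
  have "norm (signof \<pi> * (\<Prod>i = 0..<n. f i (\<pi> i)) - signof \<pi> * (\<Prod>i = 0..<n. g i (\<pi> i)))
      \<le> real n * e" if "\<pi> \<in> ?P" for \<pi>
  proof -
    have lt: "\<pi> i < n" if "i < n" for i
      using permutes_in_image[of \<pi> "{0..<n}" i] \<open>\<pi> \<in> ?P\<close> that by auto
    have "norm (signof \<pi> * (\<Prod>i = 0..<n. f i (\<pi> i)) - signof \<pi> * (\<Prod>i = 0..<n. g i (\<pi> i)))
        = norm ((\<Prod>i = 0..<n. f i (\<pi> i)) - (\<Prod>i = 0..<n. g i (\<pi> i)))"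
      unfolding right_diff_distrib[symmetric] norm_mult by (simp add: sign_def)
    also have "\<dots> \<le> (\<Sum>i = 0..<n. norm (f i (\<pi> i) - g i (\<pi> i)))"
      by (rule norm_prod_diff) (auto intro: assms lt)
    also have "\<dots> \<le> (\<Sum>i = 0..<n. e)"
      by (rule sum_mono) (auto intro: assms lt)
    finally show ?thesis by simp
  qed
  then have "norm (\<Sum>\<pi>\<in>?P. signof \<pi> * (\<Prod>i = 0..<n. f i (\<pi> i)) -
      signof \<pi> * (\<Prod>i = 0..<n. g i (\<pi> i))) \<le> of_nat (card ?P) * (real n * e)"
    by (rule sum_norm_bound)
  then show ?thesis
    by (simp add: det sum_subtractf card_permutations)
qed

section \<open>The blended matrices\<close>

text \<open>The families \<open>b\<close> and \<open>p\<close> are indexed from \<open>1\<close>, as the symbols are.\<close>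

definition blend :: "nat \<Rightarrow> (nat \<Rightarrow> nat \<Rightarrow> complex) \<Rightarrow> complex \<Rightarrow> (nat \<Rightarrow> real) \<Rightarrow> complex mat"
  where "blend n b \<sigma> p = Matrix.mat n n (\<lambda>(i, j). of_real (p (Suc i)) * b (Suc i) (Suc j) -
    (if i = j then of_real (1 - p (Suc i)) * \<sigma> else 0))"

definition edge :: "nat \<Rightarrow> real \<Rightarrow> nat \<Rightarrow> real"
  where "edge \<kappa> s i = (if i < \<kappa> then 1 else if i = \<kappa> then s else 0)"

lemma blend_cong:
  "(\<And>i. i \<in> {1..n} \<Longrightarrow> p i = p' i) \<Longrightarrow> blend n b \<sigma> p = blend n b \<sigma> p'"
  by (intro eq_matI) (auto simp: blend_def)

text \<open>Dividing the entries by their bound \<open>K\<close> reduces the estimate to the case of entries in the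
  unit disc, where products are Lipschitz with constant one in each factor.\<close>

lemma det_blend_lipschitz:
  assumes "K \<ge> 1" and "norm \<sigma> = 1"
    and b: "\<And>i j. i \<in> {1..n} \<Longrightarrow> j \<in> {1..n} \<Longrightarrow> norm (b i j) \<le> K"
    and p: "\<And>i. i \<in> {1..n} \<Longrightarrow> p i \<in> {0..1}"
    and p': "\<And>i. i \<in> {1..n} \<Longrightarrow> p' i \<in> {0..1}"
    and close: "\<And>i. i \<in> {1..n} \<Longrightarrow> \<bar>p i - p' i\<bar> \<le> e"
  shows "norm (Determinant.det (blend n b \<sigma> p) - Determinant.det (blend n b \<sigma> p'))
    \<le> K ^ n * fact n * real n * 2 * e"
proof -
  define f where "f p i j = (of_real (p (Suc i)) * b (Suc i) (Suc j) -
    (if i = j then of_real (1 - p (Suc i)) * \<sigma> else 0)) / of_real K" for p :: "nat \<Rightarrow> real" and i j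
  have K0: "K > 0" using assms(1) by simp
  have scale: "Determinant.det (blend n b \<sigma> p) =
      of_real (K ^ n) * Determinant.det (Matrix.mat n n (\<lambda>(i, j). f p i j))" for p
  proof -
    have "blend n b \<sigma> p = Matrix.mat n n (\<lambda>(i, j). of_real K * f p i j * 1)"
      using K0 by (auto simp: blend_def f_def)
    then show ?thesis
      by (simp only: det_scale_rows_cols) simp
  qed
  have bound: "norm (f p i j) \<le> 1" if "i < n" "j < n" "p (Suc i) \<in> {0..1}" for p i j
  proof -
    let ?t = "p (Suc i)"
    have "norm (of_real ?t * b (Suc i) (Suc j)) \<le> ?t * K"
      using that b[of "Suc i" "Suc j"] by (auto simp: norm_mult intro!: mult_left_mono)
    moreover have "norm (if i = j then of_real (1 - ?t) * \<sigma> else 0) \<le> (1 - ?t) * 1"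
      using that assms(2) by (auto simp: norm_mult simp del: of_real_diff)
    moreover have "(1 - ?t) * 1 \<le> (1 - ?t) * K"
      using that assms(1) by (intro mult_left_mono) auto
    ultimately have "norm (of_real ?t * b (Suc i) (Suc j)
        - (if i = j then of_real (1 - ?t) * \<sigma> else 0)) \<le> ?t * K + (1 - ?t) * K"
      by (intro order.trans[OF norm_triangle_ineq4]) linarith
    then show ?thesis
      using K0 by (simp add: f_def norm_divide algebra_simps)
  qed
  have diff: "norm (f p i j - f p' i j) \<le> 2 * e" if "i < n" "j < n" for i j
  proof -
    let ?d = "p (Suc i) - p' (Suc i)"
    have "f p i j - f p' i j =
        of_real ?d * ((b (Suc i) (Suc j) + (if i = j then \<sigma> else 0)) / of_real K)"
      using K0 by (simp add: f_def field_simps)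
    moreover have "norm ((b (Suc i) (Suc j) + (if i = j then \<sigma> else 0)) / of_real K) \<le> 2"
    proof -
      have "norm (b (Suc i) (Suc j) + (if i = j then \<sigma> else 0)) \<le> K + 1"
        using that b[of "Suc i" "Suc j"] assms(2)
        by (intro order.trans[OF norm_triangle_ineq] add_mono) auto
      then show ?thesis
        using K0 assms(1) by (simp add: norm_divide divide_simps)
    qed
    ultimately have "norm (f p i j - f p' i j) \<le> \<bar>?d\<bar> * 2"
      by (simp only: norm_mult norm_of_real) (intro mult_left_mono, auto)
    then show ?thesis
      using close[of "Suc i"] that by simp
  qed
  have "norm (Determinant.det (Matrix.mat n n (\<lambda>(i, j). f p i j)) -
      Determinant.det (Matrix.mat n n (\<lambda>(i, j). f p' i j))) \<le> fact n * (real n * (2 * e))"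
    by (intro norm_det_diff_le_of_norm_le_1 bound diff p p') auto
  then have "K ^ n * norm (Determinant.det (Matrix.mat n n (\<lambda>(i, j). f p i j)) -
      Determinant.det (Matrix.mat n n (\<lambda>(i, j). f p' i j))) \<le> K ^ n * (fact n * (real n * (2 * e)))"
    using K0 by (intro mult_left_mono) auto
  moreover have "norm (of_real (K ^ n) :: complex) = K ^ n"
    using K0 by (simp add: norm_power)
  ultimately show ?thesis
    unfolding scale right_diff_distrib[symmetric] norm_mult by (simp only: mult.assoc)
qed

text \<open>The rows below \<open>\<kappa>\<close> are \<open>-\<sigma>\<close> times unit rows, so the matrix is block triangular with a scalar
  lower block.\<close>

lemma norm_det_edge:
  assumes "\<kappa> \<le> n" and "norm \<sigma> = 1"
  shows "norm (Determinant.det (blend n b \<sigma> (edge \<kappa> s))) =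
    norm (Determinant.det (blend \<kappa> b \<sigma> (edge \<kappa> s)))"
proof -
  let ?B = "Matrix.mat \<kappa> (n - \<kappa>) (\<lambda>(i, j). blend n b \<sigma> (edge \<kappa> s) $$ (i, j + \<kappa>))"
  have "blend n b \<sigma> (edge \<kappa> s) = four_block_mat (blend \<kappa> b \<sigma> (edge \<kappa> s)) ?B
      (0\<^sub>m (n - \<kappa>) \<kappa>) ((- \<sigma>) \<cdot>\<^sub>m 1\<^sub>m (n - \<kappa>))"
    using assms(1)
    by (intro eq_matI) (auto simp: blend_def edge_def four_block_mat_def Let_def)
  moreover have "Determinant.det (four_block_mat (blend \<kappa> b \<sigma> (edge \<kappa> s)) ?B
      (0\<^sub>m (n - \<kappa>) \<kappa>) ((- \<sigma>) \<cdot>\<^sub>m 1\<^sub>m (n - \<kappa>))) =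
      Determinant.det (blend \<kappa> b \<sigma> (edge \<kappa> s)) * Determinant.det ((- \<sigma>) \<cdot>\<^sub>m 1\<^sub>m (n - \<kappa>))"
    by (rule det_four_block_mat_lower_left_zero) (auto simp: blend_def)
  ultimately show ?thesis
    using assms(2) by (simp add: norm_mult norm_power)
qed

text \<open>Row \<open>i\<close> carries the factor \<open>w powr (- m\<^sub>i) (u\<^sub>i + \<rho>\<^sub>i)\<close> and column \<open>j\<close> the factor
  \<open>w powr m\<^sub>j\<close>; on the diagonal the powers of \<open>w\<close> cancel, which leaves the shift unscaled. Constant
  \<open>\<rho>\<close> gives the characteristic matrix, and \<open>\<rho>\<close> vanishing outside index \<open>n\<close> the one with \<open>E_mat n\<close>.\<close>

lemma det_shifted_symbol:
  fixes l m r \<rho> :: "nat \<Rightarrow> real"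
  assumes "w > 0"
    and r: "\<And>i. i \<in> {1..n} \<Longrightarrow> r i = l i + m i"
    and \<rho>: "\<And>i. i \<in> {1..n} \<Longrightarrow> \<rho> i \<ge> 0"
  shows "Determinant.det (Matrix.mat n n (\<lambda>(i, j). c (Suc i) (Suc j) -
      (if i = j then of_real (\<rho> (Suc i)) * \<sigma> else 0))) =
    of_real (\<Prod>i=1..n. w powr r i + \<rho> i) *
    Determinant.det (blend n (\<lambda>i j. c i j * of_real (w powr - (l i + m j))) \<sigma>
      (\<lambda>i. w powr r i / (w powr r i + \<rho> i)))"
proof -
  define row where "row i = complex_of_real (w powr - m (Suc i) * (w powr r (Suc i) + \<rho> (Suc i)))"
    for i
  define col where "col j = complex_of_real (w powr m (Suc j))" for j
  define p where "p i = w powr r i / (w powr r i + \<rho> i)" for i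
  define b where "b i j = c i j * complex_of_real (w powr - (l i + m j))" for i j
  define f where "f i j = of_real (p (Suc i)) * b (Suc i) (Suc j) -
    (if i = j then of_real (1 - p (Suc i)) * \<sigma> else 0)" for i j
  have entry: "c (Suc i) (Suc j) - (if i = j then of_real (\<rho> (Suc i)) * \<sigma> else 0) =
      row i * f i j * col j" if "i < n" "j < n" for i j
  proof -
    let ?u = "w powr r (Suc i)" and ?\<rho> = "\<rho> (Suc i)"
    have pos: "?u + ?\<rho> > 0"
      using \<rho>[of "Suc i"] that assms(1) by (intro add_pos_nonneg) auto
    have "w powr - m (Suc i) * (?u + ?\<rho>) * (p (Suc i) * w powr - (l (Suc i) + m (Suc j))) *
        w powr m (Suc j) = w powr (- m (Suc i) + r (Suc i) - (l (Suc i) + m (Suc j)) + m (Suc j))"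
      using pos assms(1) by (simp add: p_def powr_add powr_diff powr_minus divide_simps)
    also have "\<dots> = 1"
      using r[of "Suc i"] that assms(1) by simp
    finally have 1: "complex_of_real (w powr - m (Suc i) * (?u + ?\<rho>) *
        (p (Suc i) * w powr - (l (Suc i) + m (Suc j))) * w powr m (Suc j)) = 1"
      by simp
    have "w powr - m (Suc i) * (?u + ?\<rho>) * (1 - p (Suc i)) * w powr m (Suc i) = ?\<rho>"
    proof -
      have "1 - p (Suc i) = ?\<rho> / (?u + ?\<rho>)"
        using pos by (simp add: p_def field_simps)
      then show ?thesis
        using pos assms(1) by (simp add: powr_minus)
    qed
    then have 2: "complex_of_real (w powr - m (Suc i) * (?u + ?\<rho>) * (1 - p (Suc i)) *
        w powr m (Suc i)) = of_real ?\<rho>"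
      by simp
    have "row i * f i j * col j =
        c (Suc i) (Suc j) * complex_of_real (w powr - m (Suc i) * (?u + ?\<rho>) *
          (p (Suc i) * w powr - (l (Suc i) + m (Suc j))) * w powr m (Suc j)) -
        (if i = j then complex_of_real (w powr - m (Suc i) * (?u + ?\<rho>) * (1 - p (Suc i)) *
          w powr m (Suc i)) * \<sigma> else 0)"
      by (simp only: row_def f_def b_def col_def of_real_mult) (simp add: algebra_simps)
    then show ?thesis
      by (simp only: 1 2) simp
  qed
  have "Matrix.mat n n (\<lambda>(i, j). c (Suc i) (Suc j) -
      (if i = j then of_real (\<rho> (Suc i)) * \<sigma> else 0)) =
      Matrix.mat n n (\<lambda>(i, j). row i * f i j * col j)"
    using entry by (intro eq_matI) auto
  moreover have "Matrix.mat n n (\<lambda>(i, j). f i j) = blend n b \<sigma> p"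
    by (simp add: blend_def f_def)
  moreover have "(\<Prod>i<n. row i) * (\<Prod>j<n. col j) = of_real (\<Prod>i=1..n. w powr r i + \<rho> i)"
  proof -
    have "row i * col i = of_real (w powr r (Suc i) + \<rho> (Suc i))" for i
    proof -
      have "w powr - m (Suc i) * (w powr r (Suc i) + \<rho> (Suc i)) * w powr m (Suc i) =
          w powr r (Suc i) + \<rho> (Suc i)"
        using assms(1) by (simp add: powr_minus)
      then show ?thesis
        unfolding row_def col_def of_real_mult[symmetric] by (simp only:)
    qed
    then show ?thesis
      by (simp add: prod.atLeast1_atMost_eq flip: prod.distrib)
  qed
  ultimately show ?thesis
    unfolding b_def[abs_def] p_def[abs_def] by (simp add: det_scale_rows_cols)
qed

section \<open>The curve of weights and the broken line of edges\<close>

lemma eventually_separated_powers: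
  fixes r :: "nat \<Rightarrow> real"
  assumes "\<And>i j. 1 \<le> i \<Longrightarrow> i < j \<Longrightarrow> j \<le> q \<Longrightarrow> r i > r j" and "e > 0"
  shows "\<exists>R\<ge>0. \<forall>w\<ge>R. \<forall>i j. 1 \<le> i \<longrightarrow> i < j \<longrightarrow> j \<le> q \<longrightarrow> w powr r j \<le> e * w powr r i"
proof -
  have "\<forall>\<^sub>F w in at_top. \<forall>(i, j)\<in>{(i, j). 1 \<le> i \<and> i < j \<and> j \<le> q}. w powr r j \<le> e * w powr r i"
  proof (rule eventually_ball_finite)
    show "finite {(i, j). 1 \<le> i \<and> i < j \<and> j \<le> q}"
      by (rule finite_subset[of _ "{1..q} \<times> {1..q}"]) auto
    show "\<forall>ij\<in>{(i, j). 1 \<le> i \<and> i < j \<and> j \<le> q}.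
        \<forall>\<^sub>F w in at_top. case ij of (i, j) \<Rightarrow> w powr r j \<le> e * w powr r i"
    proof clarify
      fix i j :: nat
      assume "1 \<le> i" "i < j" "j \<le> q"
      then have "r j - r i < 0"
        using assms(1) by simp
      then have "((\<lambda>w::real. w powr (r j - r i)) \<longlongrightarrow> 0) at_top"
        by (rule tendsto_neg_powr) (rule filterlim_ident)
      then have "\<forall>\<^sub>F w::real in at_top. w powr (r j - r i) < e"
        using assms(2) by (rule order_tendstoD)
      then show "\<forall>\<^sub>F w in at_top. w powr r j \<le> e * w powr r i"
        using eventually_gt_at_top[of 0]
        by eventually_elim (auto simp: powr_diff divide_simps split: if_splits)
    qed
  qed
  then obtain N where "\<forall>w\<ge>N. \<forall>(i, j)\<in>{(i, j). 1 \<le> i \<and> i < j \<and> j \<le> q}.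
      w powr r j \<le> e * w powr r i"
    by (auto simp: eventually_at_top_linorder)
  then show ?thesis
    by (intro exI[of _ "max 0 N"]) auto
qed

text \<open>The function \<open>\<rho> / u \<mapsto> u / (u + \<rho>)\<close> tends to \<open>1\<close> at zero and to \<open>0\<close> at infinity, so only an index
  at which \<open>u\<^sub>i\<close> is comparable to \<open>\<rho>\<close> keeps a weight away from both; this index is \<open>\<kappa>\<close>.\<close>

lemma weight_near_edge:
  fixes u :: "nat \<Rightarrow> real"
  assumes u: "u i > 0" and "\<rho> \<ge> 0" and "e \<ge> 0"
    and before: "i < \<kappa> \<Longrightarrow> \<rho> \<le> e * u i"
    and at: "i = \<kappa> \<Longrightarrow> \<bar>u \<kappa> / (u \<kappa> + \<rho>) - s\<bar> \<le> e"
    and after: "\<kappa> < i \<Longrightarrow> u i \<le> e * \<rho>"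
  shows "\<bar>u i / (u i + \<rho>) - edge \<kappa> s i\<bar> \<le> e"
proof -
  have pos: "u i + \<rho> > 0" using u assms(2) by linarith
  consider "i < \<kappa>" | "i = \<kappa>" | "\<kappa> < i" by linarith
  then show ?thesis
  proof cases
    case 1
    have "u i / (u i + \<rho>) - 1 = - (\<rho> / (u i + \<rho>))"
      using pos by (simp add: field_simps)
    moreover have "\<rho> / (u i + \<rho>) \<le> e"
    proof -
      have "\<rho> \<le> e * (u i + \<rho>)"
        using before[OF 1] assms(2,3) by (simp add: distrib_left add_increasing2)
      then show ?thesis using pos by (simp add: divide_simps)
    qed
    ultimately show ?thesis
      using 1 pos assms(2) by (simp add: edge_def)
  next
    case 2
    then show ?thesis using at by (simp add: edge_def)
  next
    case 3
    have "u i \<le> e * (u i + \<rho>)"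
      using after[OF 3] u assms(3) by (simp add: distrib_left add_increasing)
    then show ?thesis
      using 3 pos u by (simp add: edge_def divide_simps)
  qed
qed

text \<open>The active index is the first one whose successor is dominated by \<open>\<rho>\<close>: for \<open>i\<close>
  before it, \<open>\<rho>\<close> is below \<open>u\<^sub>i\<^sub>+\<^sub>1 / e\<close>, hence below \<open>e u\<^sub>i\<close>. Widely separated \<open>u\<^sub>i\<close> thus leave
  no room for \<open>\<rho>\<close> to be comparable to two of them.\<close>

lemma curve_near_edges:
  fixes u :: "nat \<Rightarrow> real"
  assumes "1 \<le> q" and "\<rho> \<ge> 0" and "0 < e" and "e \<le> 1"
    and u: "\<And>i. i \<in> {1..q} \<Longrightarrow> u i > 0"
    and sep: "\<And>i j. 1 \<le> i \<Longrightarrow> i < j \<Longrightarrow> j \<le> q \<Longrightarrow> u j \<le> e\<^sup>2 * u i"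
  shows "\<exists>\<kappa>\<in>{1..q}. \<forall>i\<in>{1..q}. \<bar>u i / (u i + \<rho>) - edge \<kappa> (u \<kappa> / (u \<kappa> + \<rho>)) i\<bar> \<le> e"
proof -
  define P where "P \<kappa> \<longleftrightarrow> 1 \<le> \<kappa> \<and> (\<kappa> = q \<or> u (Suc \<kappa>) \<le> e * \<rho>)" for \<kappa>
  define \<kappa> where "\<kappa> = (LEAST \<kappa>. P \<kappa>)"
  have "P q" using assms(1) by (simp add: P_def)
  then have P\<kappa>: "P \<kappa>" and \<kappa>q: "\<kappa> \<le> q"
    unfolding \<kappa>_def by (rule LeastI, rule Least_le)
  have least: "\<not> P i" if "i < \<kappa>" for i
    using that unfolding \<kappa>_def by (rule not_less_Least)
  have "\<bar>u i / (u i + \<rho>) - edge \<kappa> (u \<kappa> / (u \<kappa> + \<rho>)) i\<bar> \<le> e" if i: "i \<in> {1..q}" for i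
  proof (rule weight_near_edge)
    show "\<rho> \<le> e * u i" if "i < \<kappa>"
    proof -
      have "e * \<rho> < u (Suc i)"
        using least[OF that] that i \<kappa>q by (auto simp: P_def)
      also have "\<dots> \<le> e * (e * u i)"
        using sep[of i "Suc i"] that i \<kappa>q by (simp add: power2_eq_square)
      finally show ?thesis
        using assms(3) by simp
    qed
    show "u i \<le> e * \<rho>" if "\<kappa> < i"
    proof -
      have next_le: "u (Suc \<kappa>) \<le> e * \<rho>"
        using P\<kappa> that i by (auto simp: P_def)
      have "u i \<le> u (Suc \<kappa>)"
      proof (cases "i = Suc \<kappa>")
        case False
        then have "u i \<le> e\<^sup>2 * u (Suc \<kappa>)"
          using that i by (intro sep) auto
        also have "\<dots> \<le> 1 * u (Suc \<kappa>)"
          using u[of "Suc \<kappa>"] that i assms(3,4)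
          by (intro mult_right_mono) (auto intro: power_le_one less_imp_le)
        finally show ?thesis by simp
      qed simp
      with next_le show ?thesis by simp
    qed
  qed (use u i assms in auto)
  moreover have "\<kappa> \<in> {1..q}"
    using P\<kappa> \<kappa>q by (auto simp: P_def)
  ultimately show ?thesis by blast
qed

text \<open>Close to the ends of an edge the curve has already turned into the neighbouring edge. Hence
  \<open>s\<close> is first moved into \<open>[e, 1 - e]\<close>; the \<open>\<rho>\<close> that realises this weight at \<open>\<kappa>\<close> lies between
  \<open>e u\<^sub>\<kappa>\<close> and \<open>u\<^sub>\<kappa> / e\<close>.\<close>

lemma edges_near_curve:
  fixes u :: "nat \<Rightarrow> real"
  assumes "\<kappa> \<in> {1..q}" and "s \<in> {0..1}" and "0 < e" and "e \<le> 1 / 2"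
    and u: "\<And>i. i \<in> {1..q} \<Longrightarrow> u i > 0"
    and sep: "\<And>i j. 1 \<le> i \<Longrightarrow> i < j \<Longrightarrow> j \<le> q \<Longrightarrow> u j \<le> e\<^sup>2 * u i"
  shows "\<exists>\<rho>\<ge>0. \<forall>i\<in>{1..q}. \<bar>u i / (u i + \<rho>) - edge \<kappa> s i\<bar> \<le> e"
proof -
  define t where "t = max e (min (1 - e) s)"
  define \<rho> where "\<rho> = u \<kappa> * (1 - t) / t"
  have t: "e \<le> t" "t \<le> 1 - e" "\<bar>t - s\<bar> \<le> e"
    using assms(2-4) by (auto simp: t_def)
  have t0: "t > 0" "t < 1" using t assms(3) by auto
  have u\<kappa>: "u \<kappa> > 0" using u assms(1) by blast
  have \<rho>0: "\<rho> \<ge> 0" using t0 u\<kappa> by (simp add: \<rho>_def)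
  have "u \<kappa> + \<rho> = u \<kappa> / t"
    using t0 by (simp add: \<rho>_def field_simps)
  then have weight: "u \<kappa> / (u \<kappa> + \<rho>) = t"
    using u\<kappa> by simp
  have upper: "e * \<rho> \<le> u \<kappa>"
  proof -
    have "e * (1 - t) \<le> t * 1"
      using t t0 assms(3) by (intro mult_mono) auto
    then have "u \<kappa> * (e * (1 - t)) \<le> u \<kappa> * t"
      using u\<kappa> by simp
    then show ?thesis
      using t0 by (simp add: \<rho>_def divide_simps mult_ac)
  qed
  have lower: "e * u \<kappa> \<le> \<rho>"
  proof -
    have "e * t \<le> (1 - t) * 1"
      using t t0 assms(3) by (intro mult_mono) auto
    then have "u \<kappa> * (e * t) \<le> u \<kappa> * (1 - t)"
      using u\<kappa> by simp
    then show ?thesis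
      using t0 by (simp add: \<rho>_def divide_simps mult_ac)
  qed
  have "\<bar>u i / (u i + \<rho>) - edge \<kappa> s i\<bar> \<le> e" if i: "i \<in> {1..q}" for i
  proof (rule weight_near_edge)
    show "\<rho> \<le> e * u i" if "i < \<kappa>"
    proof -
      have "e * \<rho> \<le> e * (e * u i)"
        using upper sep[of i \<kappa>] that i assms(1) by (simp add: power2_eq_square)
      then show ?thesis
        using assms(3) by simp
    qed
    show "u i \<le> e * \<rho>" if "\<kappa> < i"
    proof -
      have "u i \<le> e * (e * u \<kappa>)"
        using sep[of \<kappa> i] that i assms(1) by (simp add: power2_eq_square)
      also have "\<dots> \<le> e * \<rho>"
        using lower assms(3) by simp
      finally show ?thesis .
    qed
  qed (use u i \<rho>0 t weight assms in auto)
  then show ?thesis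
    using \<rho>0 by blast
qed

section \<open>Symbols\<close>

lemma japanese_ge_1: "japanese \<xi> \<ge> 1"
  by (simp add: japanese_def)

lemma norm_le_japanese: "norm \<xi> \<le> japanese \<xi>"
  unfolding japanese_def by (rule real_le_rsqrt) simp

lemma symbol_class_bound:
  fixes a :: "(real ^ 'n::finite) \<times> (real ^ 'n) \<Rightarrow> complex"
  assumes "a \<in> symbol_class \<delta> \<mu>"
  shows "\<exists>K. \<forall>x \<xi>. norm (a (x, \<xi>) * of_real (japanese \<xi> powr - \<mu>)) \<le> K"
proof -
  have "foldr (\<lambda>i. id) is f = f" for "is" :: "'b list" and f :: "'c"
    by (induction "is") auto
  then have D0: "D_multi e (\<lambda>_. 0) f = f" for e :: "'n \<Rightarrow> (real ^ 'n) \<times> (real ^ 'n)" and f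
    by (simp add: D_multi_def)
  have "bdd_above (range (\<lambda>(x, \<xi>). cmod (D_\<xi> (\<lambda>_. 0) (D_x (\<lambda>_. 0) a) (x, \<xi>)) *
      japanese \<xi> powr (- \<mu> + real (multi_abs (\<lambda>_::'n. 0)) - \<delta> * real (multi_abs (\<lambda>_::'n. 0)))))"
    using assms unfolding symbol_class_def mem_Collect_eq by (elim conjE allE)
  then have "bdd_above (range (\<lambda>(x, \<xi>). cmod (a (x, \<xi>)) * japanese \<xi> powr - \<mu>))"
    by (simp add: D_\<xi>_def D_x_def D0 multi_abs_def)
  then show ?thesis
    by (auto simp: bdd_above_def norm_mult)
qed

lemma douglis_nirenberg_bound:
  assumes "douglis_nirenberg \<delta> q l m a"
  shows "\<exists>K\<ge>1. \<forall>i\<in>{1..q}. \<forall>j\<in>{1..q}. \<forall>x \<xi>.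
    norm (a i j (x, \<xi>) * of_real (japanese \<xi> powr - (l i + m j))) \<le> K"
proof -
  have "\<forall>ij\<in>{1..q} \<times> {1..q}. \<exists>K. \<forall>x \<xi>. norm (a (fst ij) (snd ij) (x, \<xi>) *
      of_real (japanese \<xi> powr - (l (fst ij) + m (snd ij)))) \<le> K"
    using assms unfolding douglis_nirenberg_def by (intro ballI symbol_class_bound[of _ \<delta>]) auto
  then obtain K where K: "\<And>i j x \<xi>. i \<in> {1..q} \<Longrightarrow> j \<in> {1..q} \<Longrightarrow>
      norm (a i j (x, \<xi>) * of_real (japanese \<xi> powr - (l i + m j))) \<le> K (i, j)"
    by (subst (asm) bchoice_iff) force
  define M where "M = Max (insert 1 (K ` ({1..q} \<times> {1..q})))"
  have "M \<ge> 1"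
    unfolding M_def by (rule Max_ge) auto
  moreover have "K (i, j) \<le> M" if "i \<in> {1..q}" "j \<in> {1..q}" for i j
    unfolding M_def by (rule Max_ge) (use that in auto)
  ultimately show ?thesis
    using order.trans[OF K] by blast
qed

lemma det_sys_mat_char:
  fixes \<rho> \<phi> :: real
  assumes "\<And>i. i \<in> {1..q} \<Longrightarrow> r i = l i + m i" and "\<rho> \<ge> 0"
  shows "cmod (Determinant.det (sys_mat a q (x, \<xi>) - rcis \<rho> \<phi> \<cdot>\<^sub>m 1\<^sub>m q)) =
    (\<Prod>i=1..q. japanese \<xi> powr r i + \<rho>) *
    cmod (Determinant.det (blend q
      (\<lambda>i j. a i j (x, \<xi>) * of_real (japanese \<xi> powr - (l i + m j))) (cis \<phi>)
      (\<lambda>i. japanese \<xi> powr r i / (japanese \<xi> powr r i + \<rho>))))"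
proof -
  have "sys_mat a q (x, \<xi>) - rcis \<rho> \<phi> \<cdot>\<^sub>m 1\<^sub>m q =
      Matrix.mat q q (\<lambda>(i, j). a (Suc i) (Suc j) (x, \<xi>) -
        (if i = j then of_real \<rho> * cis \<phi> else 0))"
    by (intro eq_matI) (auto simp: sys_mat_def rcis_def)
  moreover have "(\<Prod>i=1..q. japanese \<xi> powr r i + \<rho>) \<ge> 0"
    using assms(2) by (intro prod_nonneg) auto
  ultimately show ?thesis
    using det_shifted_symbol[of "japanese \<xi>" q r l m "\<lambda>_. \<rho>" "\<lambda>i j. a i j (x, \<xi>)" "cis \<phi>"]
      assms japanese_ge_1[of \<xi>]
    by (simp add: norm_mult del: of_real_prod)
qed

lemma det_sys_mat_minor:
  fixes \<rho> \<phi> :: real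
  assumes "\<kappa> \<in> {1..q}" and "\<And>i. i \<in> {1..q} \<Longrightarrow> r i = l i + m i" and "\<rho> \<ge> 0"
  shows "cmod (Determinant.det (sys_mat a \<kappa> (x, \<xi>) - rcis \<rho> \<phi> \<cdot>\<^sub>m E_mat \<kappa>)) =
    japanese \<xi> powr (\<Sum>i=1..<\<kappa>. r i) * (japanese \<xi> powr r \<kappa> + \<rho>) *
    cmod (Determinant.det (blend q
      (\<lambda>i j. a i j (x, \<xi>) * of_real (japanese \<xi> powr - (l i + m j))) (cis \<phi>)
      (edge \<kappa> (japanese \<xi> powr r \<kappa> / (japanese \<xi> powr r \<kappa> + \<rho>)))))"
proof -
  let ?w = "japanese \<xi>"
  let ?b = "\<lambda>i j. a i j (x, \<xi>) * of_real (?w powr - (l i + m j))"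
  let ?\<rho> = "\<lambda>i. if i = \<kappa> then \<rho> else 0"
  let ?e = "edge \<kappa> (?w powr r \<kappa> / (?w powr r \<kappa> + \<rho>))"
  have w: "?w > 0" using japanese_ge_1[of \<xi>] by linarith
  have mat: "sys_mat a \<kappa> (x, \<xi>) - rcis \<rho> \<phi> \<cdot>\<^sub>m E_mat \<kappa> =
      Matrix.mat \<kappa> \<kappa> (\<lambda>(i, j). a (Suc i) (Suc j) (x, \<xi>) -
        (if i = j then of_real (?\<rho> (Suc i)) * cis \<phi> else 0))"
    by (intro eq_matI) (auto simp: sys_mat_def rcis_def E_mat_def mat_diag_def)
  have prod: "(\<Prod>i=1..\<kappa>. ?w powr r i + ?\<rho> i) =
      ?w powr (\<Sum>i=1..<\<kappa>. r i) * (?w powr r \<kappa> + \<rho>)"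
  proof -
    have "{1..\<kappa>} = insert \<kappa> {1..<\<kappa>}" using assms(1) by auto
    moreover have "(\<Prod>i=1..<\<kappa>. ?w powr r i + ?\<rho> i) = ?w powr (\<Sum>i=1..<\<kappa>. r i)"
      using w by (simp add: powr_sum)
    ultimately show ?thesis by (simp add: mult.commute)
  qed
  have "?w powr r i / (?w powr r i + ?\<rho> i) = ?e i" if "i \<le> \<kappa>" for i
    using w that by (auto simp: edge_def)
  then have "blend \<kappa> ?b (cis \<phi>) (\<lambda>i. ?w powr r i / (?w powr r i + ?\<rho> i)) = blend \<kappa> ?b (cis \<phi>) ?e"
    by (intro blend_cong) simp
  then have "Determinant.det (sys_mat a \<kappa> (x, \<xi>) - rcis \<rho> \<phi> \<cdot>\<^sub>m E_mat \<kappa>) =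
      of_real (?w powr (\<Sum>i=1..<\<kappa>. r i) * (?w powr r \<kappa> + \<rho>)) *
      Determinant.det (blend \<kappa> ?b (cis \<phi>) ?e)"
    using det_shifted_symbol[of ?w \<kappa> r l m ?\<rho> "\<lambda>i j. a i j (x, \<xi>)" "cis \<phi>"] assms w
    unfolding mat prod by simp
  moreover have "norm (Determinant.det (blend q ?b (cis \<phi>) ?e)) =
      norm (Determinant.det (blend \<kappa> ?b (cis \<phi>) ?e))"
    using assms(1) by (intro norm_det_edge) auto
  ultimately show ?thesis
    using assms(3) by (simp add: norm_mult del: of_real_mult of_real_add)
qed

section \<open>Equivalence of the two ellipticity conditions\<close>

theorem theorem3p3:
  fixes a :: "nat \<Rightarrow> nat \<Rightarrow> (real ^ 'n::finite) \<times> (real ^ 'n) \<Rightarrow> complex"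
    and q :: nat and \<delta> \<theta> :: real and l m r :: "nat \<Rightarrow> real"
  assumes "1 \<le> q"
    and "0 \<le> \<delta>" and "\<delta> < 1"
    and "douglis_nirenberg \<delta> q l m a"
    and "\<And>i. i \<in> {1..q} \<Longrightarrow> r i = l i + m i"
    and "\<And>i j. 1 \<le> i \<Longrightarrow> i < j \<Longrightarrow> j \<le> q \<Longrightarrow> r i > r j"
    and "r q \<ge> 0"
    and "0 < \<theta>" and "\<theta> < pi"
  shows
    "(\<exists>C>0. \<exists>R\<ge>0. \<forall>x \<xi>. \<forall>\<mu>\<in>sector \<theta>. norm \<xi> \<ge> R \<longrightarrow>
        cmod (Determinant.det (sys_mat a q (x, \<xi>) - \<mu> \<cdot>\<^sub>m 1\<^sub>m q))
          \<ge> C * (\<Prod>i=1..q. japanese \<xi> powr r i + cmod \<mu>))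
     \<longleftrightarrow>
     (\<forall>\<kappa>\<in>{1..q}. \<exists>C>0. \<exists>R\<ge>0. \<forall>x \<xi>. \<forall>\<mu>\<in>sector \<theta>. norm \<xi> \<ge> R \<longrightarrow>
        cmod (Determinant.det (sys_mat a \<kappa> (x, \<xi>) - \<mu> \<cdot>\<^sub>m E_mat \<kappa>))
          \<ge> C * japanese \<xi> powr (\<Sum>i=1..<\<kappa>. r i) * (japanese \<xi> powr r \<kappa> + cmod \<mu>))"
    (is "?elliptic \<longleftrightarrow> ?minors")
proof -
  define I where "I = {\<theta>..2 * pi - \<theta>}"
  define u where "u \<xi> i = japanese \<xi> powr r i" for \<xi> :: "real ^ 'n" and i
  define curve where "curve \<xi> \<rho> i = u \<xi> i / (u \<xi> i + \<rho>)" for \<xi> :: "real ^ 'n" and \<rho> i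
  define T where "T x \<xi> \<phi> p = norm (Determinant.det (blend q
      (\<lambda>i j. a i j (x, \<xi>) * of_real (japanese \<xi> powr - (l i + m j))) (cis \<phi>) p))"
    for x \<xi> \<phi> p
  have u0: "u \<xi> i > 0" for \<xi> i
    using japanese_ge_1[of \<xi>] by (simp add: u_def)
  have curve01: "curve \<xi> \<rho> i \<in> {0..1}" if "\<rho> \<ge> 0" for \<xi> \<rho> i
    using u0[of \<xi> i] that by (auto simp: curve_def divide_simps)
  have edge01: "edge \<kappa> s i \<in> {0..1}" if "s \<in> {0..1}" for \<kappa> s i
    using that by (auto simp: edge_def)
  have all_sector: "(\<forall>\<mu>\<in>sector \<theta>. P \<mu>) \<longleftrightarrow> (\<forall>\<rho>\<ge>0. \<forall>\<phi>\<in>I. P (rcis \<rho> \<phi>))" for P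
    unfolding sector_def I_def atLeastAtMost_iff Ball_def mem_Collect_eq by blast

  have elliptic: "?elliptic \<longleftrightarrow> (\<exists>C>0. \<exists>R\<ge>0. \<forall>x \<xi>. \<forall>\<rho>\<ge>0. \<forall>\<phi>\<in>I. norm \<xi> \<ge> R \<longrightarrow>
      T x \<xi> \<phi> (curve \<xi> \<rho>) \<ge> C)"
  proof -
    have "C * (\<Prod>i=1..q. japanese \<xi> powr r i + cmod (rcis \<rho> \<phi>)) \<le>
        cmod (Determinant.det (sys_mat a q (x, \<xi>) - rcis \<rho> \<phi> \<cdot>\<^sub>m 1\<^sub>m q)) \<longleftrightarrow>
        C \<le> T x \<xi> \<phi> (curve \<xi> \<rho>)" if "\<rho> \<ge> 0" for C x \<xi> \<rho> \<phi>
    proof -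
      have "(\<Prod>i=1..q. u \<xi> i + \<rho>) > 0"
        using u0 that by (intro prod_pos) (auto intro: add_pos_nonneg)
      then show ?thesis
        using det_sys_mat_char[of q r l m \<rho> a x \<xi> \<phi>] assms(5) that
        by (simp add: T_def curve_def[abs_def] u_def mult.commute[of C])
    qed
    then show ?thesis
      unfolding all_sector by (simp cong: conj_cong)
  qed

  have minors: "?minors \<longleftrightarrow> (\<forall>\<kappa>\<in>{1..q}. \<exists>C>0. \<exists>R\<ge>0. \<forall>x \<xi>. \<forall>\<rho>\<ge>0. \<forall>\<phi>\<in>I. norm \<xi> \<ge> R \<longrightarrow>
      T x \<xi> \<phi> (edge \<kappa> (curve \<xi> \<rho> \<kappa>)) \<ge> C)"
  proof -
    have "C * japanese \<xi> powr (\<Sum>i=1..<\<kappa>. r i) * (japanese \<xi> powr r \<kappa> + cmod (rcis \<rho> \<phi>)) \<le>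
        cmod (Determinant.det (sys_mat a \<kappa> (x, \<xi>) - rcis \<rho> \<phi> \<cdot>\<^sub>m E_mat \<kappa>)) \<longleftrightarrow>
        C \<le> T x \<xi> \<phi> (edge \<kappa> (curve \<xi> \<rho> \<kappa>))" if "\<rho> \<ge> 0" "\<kappa> \<in> {1..q}" for C x \<xi> \<rho> \<phi> \<kappa>
    proof -
      define f where "f = japanese \<xi> powr (\<Sum>i=1..<\<kappa>. r i) * (japanese \<xi> powr r \<kappa> + \<rho>)"
      have "f > 0"
        using that japanese_ge_1[of \<xi>] by (auto simp: f_def intro!: mult_pos_pos add_pos_nonneg)
      moreover have "cmod (Determinant.det (sys_mat a \<kappa> (x, \<xi>) - rcis \<rho> \<phi> \<cdot>\<^sub>m E_mat \<kappa>)) =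
          f * T x \<xi> \<phi> (edge \<kappa> (curve \<xi> \<rho> \<kappa>))"
        unfolding f_def T_def curve_def u_def by (rule det_sys_mat_minor) (use assms(5) that in auto)
      moreover have "C * japanese \<xi> powr (\<Sum>i=1..<\<kappa>. r i) *
          (japanese \<xi> powr r \<kappa> + cmod (rcis \<rho> \<phi>)) = f * C"
        using that by (simp add: f_def)
      ultimately show ?thesis
        by (simp only: mult_le_cancel_left_pos)
    qed
    then show ?thesis
      unfolding all_sector by (simp cong: conj_cong)
  qed

  obtain K where K: "K \<ge> 1" and b_le: "\<And>i j x \<xi>. i \<in> {1..q} \<Longrightarrow> j \<in> {1..q} \<Longrightarrow>
      norm (a i j (x, \<xi>) * of_real (japanese \<xi> powr - (l i + m j))) \<le> K"
    using douglis_nirenberg_bound[OF assms(4)] by blast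
  define L where "L = K ^ q * fact q * real q * 2"
  have "L > 0"
    using K assms(1) by (simp add: L_def)
  have lipschitz: "T x \<xi> \<phi> p \<ge> T x \<xi> \<phi> p' - L * e"
    if "\<And>i. p i \<in> {0..1}" "\<And>i. p' i \<in> {0..1}" "\<And>i. i \<in> {1..q} \<Longrightarrow> \<bar>p i - p' i\<bar> \<le> e" for x \<xi> \<phi> p p' e
  proof -
    have "norm (Determinant.det (blend q
        (\<lambda>i j. a i j (x, \<xi>) * of_real (japanese \<xi> powr - (l i + m j))) (cis \<phi>) p) -
        Determinant.det (blend q
        (\<lambda>i j. a i j (x, \<xi>) * of_real (japanese \<xi> powr - (l i + m j))) (cis \<phi>) p')) \<le> L * e"
      unfolding L_def by (rule det_blend_lipschitz[OF K norm_cis b_le]) (use that in auto)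
    then show ?thesis
      using norm_triangle_ineq3 unfolding T_def by (smt (verit))
  qed
  \<comment> \<open>Moving the weights by at most \<open>e\<close> may cost half of a lower bound \<open>C\<close>.\<close>
  have choose_e: "\<exists>e R0. 0 < e \<and> e \<le> 1 / 2 \<and> L * e \<le> C / 2 \<and> R0 \<ge> 0 \<and>
      (\<forall>\<xi>. norm \<xi> \<ge> R0 \<longrightarrow> (\<forall>i j. 1 \<le> i \<longrightarrow> i < j \<longrightarrow> j \<le> q \<longrightarrow> u \<xi> j \<le> e\<^sup>2 * u \<xi> i))"
    if "C > 0" for C
  proof -
    define e where "e = min (1 / 2) (C / (2 * L))"
    have e: "0 < e" "e \<le> 1 / 2"
      using that \<open>L > 0\<close> by (auto simp: e_def)
    have "e \<le> C / (2 * L)"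
      by (simp add: e_def)
    then have "L * e \<le> C / 2"
      using \<open>L > 0\<close> by (simp add: field_simps)
    moreover obtain R0 where R0: "R0 \<ge> 0"
        "\<forall>w\<ge>R0. \<forall>i j. 1 \<le> i \<longrightarrow> i < j \<longrightarrow> j \<le> q \<longrightarrow> w powr r j \<le> e\<^sup>2 * w powr r i"
      using eventually_separated_powers[of q r "e\<^sup>2"] assms(6) e by auto
    moreover have "R0 \<le> japanese \<xi>" if "R0 \<le> norm \<xi>" for \<xi> :: "real ^ 'n"
      using that norm_le_japanese[of \<xi>] by simp
    then have "\<forall>\<xi>. norm \<xi> \<ge> R0 \<longrightarrow>
        (\<forall>i j. 1 \<le> i \<longrightarrow> i < j \<longrightarrow> j \<le> q \<longrightarrow> u \<xi> j \<le> e\<^sup>2 * u \<xi> i)"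
      using R0(2) unfolding u_def by blast
    ultimately show ?thesis
      using e by blast
  qed

  show ?thesis
    unfolding elliptic minors
  proof
    assume "\<exists>C>0. \<exists>R\<ge>0. \<forall>x \<xi>. \<forall>\<rho>\<ge>0. \<forall>\<phi>\<in>I. norm \<xi> \<ge> R \<longrightarrow> T x \<xi> \<phi> (curve \<xi> \<rho>) \<ge> C"
    then obtain C R where C: "C > 0" and R: "R \<ge> 0"
      and ell: "\<And>x \<xi> \<rho> \<phi>. \<rho> \<ge> 0 \<Longrightarrow> \<phi> \<in> I \<Longrightarrow> norm \<xi> \<ge> R \<Longrightarrow> T x \<xi> \<phi> (curve \<xi> \<rho>) \<ge> C"
      by blast
    obtain e R0 where e: "0 < e" "e \<le> 1 / 2" "L * e \<le> C / 2" "R0 \<ge> 0"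
      and sep: "\<And>\<xi> i j. norm \<xi> \<ge> R0 \<Longrightarrow> 1 \<le> i \<Longrightarrow> i < j \<Longrightarrow> j \<le> q \<Longrightarrow> u \<xi> j \<le> e\<^sup>2 * u \<xi> i"
      using choose_e[OF C] by blast
    show "\<forall>\<kappa>\<in>{1..q}. \<exists>C>0. \<exists>R\<ge>0. \<forall>x \<xi>. \<forall>\<rho>\<ge>0. \<forall>\<phi>\<in>I. norm \<xi> \<ge> R \<longrightarrow>
        T x \<xi> \<phi> (edge \<kappa> (curve \<xi> \<rho> \<kappa>)) \<ge> C"
    proof (rule ballI, rule exI[of _ "C / 2"], rule conjI, use C in simp,
        rule exI[of _ "max R R0"], intro conjI allI impI ballI)
      fix \<kappa> and x \<xi> :: "real ^ 'n" and \<rho> \<phi> :: real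
      assume \<kappa>: "\<kappa> \<in> {1..q}" and "\<rho> \<ge> 0" and \<phi>: "\<phi> \<in> I" and \<xi>: "max R R0 \<le> norm \<xi>"
      obtain \<rho>' where \<rho>': "\<rho>' \<ge> 0"
        "\<And>i. i \<in> {1..q} \<Longrightarrow> \<bar>curve \<xi> \<rho>' i - edge \<kappa> (curve \<xi> \<rho> \<kappa>) i\<bar> \<le> e"
        using edges_near_curve[OF \<kappa> curve01[OF \<open>\<rho> \<ge> 0\<close>] e(1,2), of "u \<xi>" \<xi> \<kappa>] u0 sep[of \<xi>] \<xi>
        unfolding curve_def by auto
      have "C / 2 \<le> T x \<xi> \<phi> (curve \<xi> \<rho>') - L * e"
        using ell[of \<rho>' \<phi> \<xi> x] \<rho>'(1) \<phi> \<xi> e(3) by simp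
      also have "\<dots> \<le> T x \<xi> \<phi> (edge \<kappa> (curve \<xi> \<rho> \<kappa>))"
        using \<rho>' \<open>\<rho> \<ge> 0\<close> by (intro lipschitz edge01 curve01) (simp_all add: abs_minus_commute)
      finally show "C / 2 \<le> T x \<xi> \<phi> (edge \<kappa> (curve \<xi> \<rho> \<kappa>))" .
    qed (use R in auto)
  next
    assume "\<forall>\<kappa>\<in>{1..q}. \<exists>C>0. \<exists>R\<ge>0. \<forall>x \<xi>. \<forall>\<rho>\<ge>0. \<forall>\<phi>\<in>I. norm \<xi> \<ge> R \<longrightarrow>
      T x \<xi> \<phi> (edge \<kappa> (curve \<xi> \<rho> \<kappa>)) \<ge> C"
    then obtain C' R' where C': "\<And>\<kappa>. \<kappa> \<in> {1..q} \<Longrightarrow> C' \<kappa> > 0"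
      and min': "\<And>\<kappa> x \<xi> \<rho> \<phi>. \<kappa> \<in> {1..q} \<Longrightarrow> \<rho> \<ge> 0 \<Longrightarrow> \<phi> \<in> I \<Longrightarrow> norm \<xi> \<ge> R' \<kappa> \<Longrightarrow>
        T x \<xi> \<phi> (edge \<kappa> (curve \<xi> \<rho> \<kappa>)) \<ge> C' \<kappa>"
      by metis
    define C where "C = Min (C' ` {1..q})"
    define R where "R = Max (R' ` {1..q})"
    have C: "C > 0" and le: "\<And>\<kappa>. \<kappa> \<in> {1..q} \<Longrightarrow> C \<le> C' \<kappa> \<and> R' \<kappa> \<le> R"
      using C' assms(1) by (auto simp: C_def R_def)
    obtain e R0 where e: "0 < e" "e \<le> 1 / 2" "L * e \<le> C / 2" "R0 \<ge> 0"
      and sep: "\<And>\<xi> i j. norm \<xi> \<ge> R0 \<Longrightarrow> 1 \<le> i \<Longrightarrow> i < j \<Longrightarrow> j \<le> q \<Longrightarrow> u \<xi> j \<le> e\<^sup>2 * u \<xi> i"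
      using choose_e[OF C] by blast
    have e1: "e \<le> 1" using e by simp
    show "\<exists>C>0. \<exists>R\<ge>0. \<forall>x \<xi>. \<forall>\<rho>\<ge>0. \<forall>\<phi>\<in>I. norm \<xi> \<ge> R \<longrightarrow> T x \<xi> \<phi> (curve \<xi> \<rho>) \<ge> C"
    proof (rule exI[of _ "C / 2"], rule conjI, use C in simp,
        rule exI[of _ "max R R0"], intro conjI allI impI ballI)
      fix x \<xi> :: "real ^ 'n" and \<rho> \<phi> :: real
      assume \<rho>: "\<rho> \<ge> 0" and \<phi>: "\<phi> \<in> I" and \<xi>: "max R R0 \<le> norm \<xi>"
      obtain \<kappa> where \<kappa>: "\<kappa> \<in> {1..q}"
        "\<And>i. i \<in> {1..q} \<Longrightarrow> \<bar>curve \<xi> \<rho> i - edge \<kappa> (curve \<xi> \<rho> \<kappa>) i\<bar> \<le> e"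
        using curve_near_edges[OF assms(1) \<rho> e(1) e1, of "u \<xi>"] u0 sep[of \<xi>] \<xi>
        unfolding curve_def by auto
      have "C \<le> T x \<xi> \<phi> (edge \<kappa> (curve \<xi> \<rho> \<kappa>))"
        using min'[of \<kappa> \<rho> \<phi> \<xi> x] le[of \<kappa>] \<kappa>(1) \<rho> \<phi> \<xi> by force
      then have "C / 2 \<le> T x \<xi> \<phi> (edge \<kappa> (curve \<xi> \<rho> \<kappa>)) - L * e"
        using e(3) by simp
      also have "\<dots> \<le> T x \<xi> \<phi> (curve \<xi> \<rho>)"
        using \<kappa> \<rho> by (intro lipschitz edge01 curve01) simp_all
      finally show "C / 2 \<le> T x \<xi> \<phi> (curve \<xi> \<rho>)" .
    qed (use e in auto)
  qed
qed

end
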